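(* For all real $a,b>0$ with $a\neq b$, writing $A,G,P,X$ for $A(a,b),G(a,b),P(a,b),X(a,b)$, one has $$A+G-P<X<\frac{P^2}{A}<\frac{A+G}{2}.$$
   Context: For real $a,b>0$ with $a\neq b$: $A(a,b)=\frac{a+b}{2}$, $G(a,b)=\sqrt{ab}$, $P(a,b)=\dfrac{a-b}{2\arcsin\left(\frac{a-b}{a+b}\right)}$ (Seiffert mean), and $X(a,b)=A\,e^{G/P-1}$. *)

theory Defs
  imports Complex_Main
begin

definition arithmetic_mean :: "real \<Rightarrow> real \<Rightarrow> real" where
  "arithmetic_mean a b = (a + b) / 2"

definition geometric_mean :: "real \<Rightarrow> real \<Rightarrow> real" where
  "geometric_mean a b = sqrt (a * b)"

(* Meaningful only for a, b > 0 with a ~= b; on the diagonal this formula gives 0 / 0 = 0,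
   not the continuous extension P(a, a) = a. *)
definition seiffert_mean :: "real \<Rightarrow> real \<Rightarrow> real" where
  "seiffert_mean a b = (a - b) / (2 * arcsin ((a - b) / (a + b)))"

definition X_mean :: "real \<Rightarrow> real \<Rightarrow> real" where
  "X_mean a b = arithmetic_mean a b * exp (geometric_mean a b / seiffert_mean a b - 1)"

end

theory Submission
  imports Defs "HOL-Real_Asymp.Real_Asymp"
begin

text \<open>
  With \<open>t = \<bar>arcsin ((a - b) / (a + b))\<bar> \<in> (0, \<pi>/2)\<close>, all means are multiples of \<open>A\<close>:
  \<open>G = A cos t\<close>, \<open>P = A sin t / t\<close> and \<open>X = A exp (t cot t - 1)\<close>. The third inequality is
  \<open>sin (t/2) < t/2\<close>. The other two, after taking logarithms, compare functions that agree at \<open>0\<close>,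
  so it suffices to sign derivatives. Put \<open>s = sin t / t\<close>. For the second inequality the derivative
  has the sign of \<open>t\<^sup>2 + t sin t cos t - 2 sin\<^sup>2 t\<close>; for the first it has the sign of
  \<open>(1 - s) (s + s\<^sup>2 - 1 - cos t)\<close>, and \<open>s + s\<^sup>2 > 1 + cos t\<close> is Wilker's inequality
  \<open>(sin u / u)\<^sup>2 + tan u / u > 2\<close> at \<open>u = t/2\<close>.
\<close>

text \<open>\<open>f\<close> increases strictly on (0, B), so \<open>f (t / 2)\<close> is at least
  the limit 0, and passing on to \<open>t\<close> restores strictness. A right-hand limit replaces
  the value at 0 because quotients such as \<open>sin t / t\<close> evaluate to 0 there.\<close>

lemma pos_if_deriv_pos_tendsto_0:
  fixes f f' :: "real \<Rightarrow> real"
  assumes deriv: "\<And>x. 0 < x \<Longrightarrow> x < B \<Longrightarrow> (f has_real_derivative f' x) (at x)"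
    and pos: "\<And>x. 0 < x \<Longrightarrow> x < B \<Longrightarrow> f' x > 0"
    and lim: "(f \<longlongrightarrow> 0) (at_right 0)"
    and t: "0 < t" "t < B"
  shows "f t > 0"
proof -
  have incr: "f x < f y" if "0 < x" "x < y" "y < B" for x y
    using that by (intro DERIV_pos_imp_increasing[of x y f]) (auto intro!: exI deriv pos)
  have "0 \<le> f (t / 2)"
  proof (rule tendsto_upperbound[OF lim])
    have "eventually (\<lambda>x. x \<in> {0<..<t / 2}) (at_right (0::real))"
      using t by (intro eventually_at_right_real) auto
    then show "eventually (\<lambda>x. f x \<le> f (t / 2)) (at_right 0)"
      by eventually_elim (use t in \<open>auto intro!: less_imp_le incr\<close>)
  qed simp
  also have "\<dots> < f t"
    using t by (intro incr) auto
  finally show ?thesis .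
qed

section \<open>Trigonometric inequalities that sign the derivatives\<close>

lemma sin_less_self:
  fixes t :: real
  assumes "0 < t" "t < pi"
  shows "sin t < t"
proof -
  let ?f = "\<lambda>t::real. t - sin t"
  have "0 < ?f t"
  proof (rule pos_if_deriv_pos_tendsto_0[where f = ?f and B = pi and f' = "\<lambda>t. 1 - cos t"])
    show "(?f has_real_derivative 1 - cos x) (at x)" for x :: real
      by (rule derivative_eq_intros refl)+ simp
    show "0 < 1 - cos x" if "0 < x" "x < pi" for x :: real
      using cos_monotone_0_pi[of 0 x] that by simp
    show "(?f \<longlongrightarrow> 0) (at_right 0)"
      by real_asymp
  qed (use assms in simp_all)
  then show ?thesis by simp
qed

lemma mult_cos_less_sin:
  fixes t :: real
  assumes "0 < t" "t < pi"
  shows "t * cos t < sin t"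
proof -
  let ?f = "\<lambda>t::real. sin t - t * cos t"
  have "0 < ?f t"
  proof (rule pos_if_deriv_pos_tendsto_0[where f = ?f and B = pi and f' = "\<lambda>t. t * sin t"])
    show "(?f has_real_derivative x * sin x) (at x)" for x :: real
      by (rule derivative_eq_intros refl)+ simp
    show "(?f \<longlongrightarrow> 0) (at_right 0)"
      by real_asymp
  qed (use assms in \<open>simp_all add: sin_gt_zero\<close>)
  then show ?thesis by simp
qed

text \<open>The difference of the two sides has derivative \<open>2 - 2 * cos t - t * sin t\<close>,
  whose own derivative \<open>sin t - t * cos t\<close> is positive; both functions tend to 0 at
  0.\<close>

lemma Cusa_Huygens:
  fixes t :: real
  assumes "0 < t" "t < pi"
  shows "3 * sin t < t * (2 + cos t)"
proof -
  let ?f = "\<lambda>t::real. 2 - 2 * cos t - t * sin t"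
  have d: "0 < ?f t" if "0 < t" "t < pi" for t :: real
  proof (rule pos_if_deriv_pos_tendsto_0[where f = ?f and B = pi and f' = "\<lambda>t. sin t - t * cos t"])
    show "(?f has_real_derivative sin x - x * cos x) (at x)" for x :: real
      by (rule derivative_eq_intros refl)+ simp
    show "(?f \<longlongrightarrow> 0) (at_right 0)"
      by real_asymp
  qed (use that in \<open>simp_all add: mult_cos_less_sin\<close>)
  let ?f = "\<lambda>t::real. t * (2 + cos t) - 3 * sin t"
  have "0 < ?f t"
  proof (rule pos_if_deriv_pos_tendsto_0[where f = ?f and B = pi
      and f' = "\<lambda>t. 2 - 2 * cos t - t * sin t"])
    show "(?f has_real_derivative 2 - 2 * cos x - x * sin x) (at x)" for x :: real
      by (rule derivative_eq_intros refl)+ simp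
    show "(?f \<longlongrightarrow> 0) (at_right 0)"
      by real_asymp
  qed (use assms d in simp_all)
  then show ?thesis by simp
qed

lemma two_sin_sq_less:
  fixes t :: real
  assumes "0 < t" "t < pi / 2"
  shows "2 * (sin t)\<^sup>2 < t\<^sup>2 + t * sin t * cos t"
proof -
  \<comment> \<open>Four times the difference of the two sides, written in the double angle so that
    its derivative is twice the Cusa-Huygens difference at \<open>2 * t\<close>.\<close>
  let ?f = "\<lambda>t::real. 2 * t * sin (2 * t) - 4 + 4 * cos (2 * t) + 4 * t\<^sup>2"
  have "0 < ?f t"
  proof (rule pos_if_deriv_pos_tendsto_0[where f = ?f and B = "pi / 2"
      and f' = "\<lambda>t. 2 * (2 * t * (2 + cos (2 * t)) - 3 * sin (2 * t))"])
    show "(?f has_real_derivative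
        2 * (2 * x * (2 + cos (2 * x)) - 3 * sin (2 * x))) (at x)" for x :: real
      by (rule derivative_eq_intros refl)+ (simp add: algebra_simps)
    show "0 < 2 * (2 * x * (2 + cos (2 * x)) - 3 * sin (2 * x))" if "0 < x" "x < pi / 2" for x :: real
      using Cusa_Huygens[of "2 * x"] that by simp
    show "(?f \<longlongrightarrow> 0) (at_right 0)"
      by real_asymp
  qed (use assms in simp_all)
  then show ?thesis
    unfolding sin_double cos_double_sin by (simp add: algebra_simps power2_eq_square)
qed

text \<open>Multiplied by \<open>u\<^sup>2\<close>, the difference of the two sides of Wilker's
  inequality and its first derivative tend to 0 at 0, so a positive second derivative
  suffices.\<close>

lemma Wilker:
  fixes u :: real
  assumes "0 < u" "u < pi / 2"
  shows "2 * u\<^sup>2 < u * tan u + (sin u)\<^sup>2"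
proof -
  define f' where "f' u = tan u + u * inverse ((cos u)\<^sup>2) + 2 * sin u * cos u - 4 * u" for u :: real
  define f'' where "f'' u = 2 * inverse ((cos u)\<^sup>2) + 2 * u * sin u / (cos u) ^ 3
    + 2 * (cos u)\<^sup>2 - 2 * (sin u)\<^sup>2 - 4" for u :: real
  have f''_pos: "f'' u > 0" if u: "0 < u" "u < pi / 2" for u
  proof -
    have c: "0 < cos u" "cos u \<le> 1" and s: "0 < sin u"
      using u by (auto intro!: cos_gt_zero sin_gt_zero)
    \<comment> \<open>This is (1 + s^2) (1 - s^2) \<le> 1 with s = \<open>sin u\<close>. The bounds
      \<open>1\<close> and \<open>2\<close> are chosen so that inserting them into
      \<open>f'' u\<close> makes all terms cancel, and the strictness of \<open>2\<close> gives
      \<open>f'' u > 0\<close>.\<close>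
    have "(1 + (sin u)\<^sup>2) * (cos u)\<^sup>2 \<le> 1"
      by (simp add: cos_squared_eq algebra_simps)
    then have 1: "inverse ((cos u)\<^sup>2) \<ge> 1 + (sin u)\<^sup>2"
      using c by (simp add: inverse_eq_divide pos_le_divide_eq)
    have "sin u * sin u * cos u ^ 3 \<le> sin u * sin u * 1"
      using c s by (intro mult_left_mono power_le_one) auto
    also have "\<dots> < u * sin u"
      using s sin_less_self[of u] u by simp
    finally have 2: "u * sin u / cos u ^ 3 > (sin u)\<^sup>2"
      using c by (simp add: field_simps power2_eq_square)
    show ?thesis
      using 1 2 unfolding f''_def cos_squared_eq by simp
  qed
  have f'_pos: "f' u > 0" if "0 < u" "u < pi / 2" for u
  proof (rule pos_if_deriv_pos_tendsto_0[where f = f' and B = "pi / 2" and f' = f''])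
    show "(f' has_real_derivative f'' x) (at x)" if "0 < x" "x < pi / 2" for x
    proof -
      have cos: "cos x \<noteq> 0" using cos_gt_zero[of x] that by simp
      show ?thesis unfolding f'_def f''_def
        by (rule DERIV_cong, (rule derivative_intros power_not_zero cos)+)
          (use cos in \<open>simp add: field_simps power2_eq_square power3_eq_cube\<close>)
    qed
    show "(f' \<longlongrightarrow> 0) (at_right 0)" unfolding f'_def by real_asymp
  qed (use f''_pos that in auto)
  let ?f = "\<lambda>u::real. u * tan u + (sin u)\<^sup>2 - 2 * u\<^sup>2"
  have "0 < ?f u"
  proof (rule pos_if_deriv_pos_tendsto_0[where f = ?f and B = "pi / 2" and f' = f'])
    show "(?f has_real_derivative f' x) (at x)" if "0 < x" "x < pi / 2" for x
    proof -
      have cos: "cos x \<noteq> 0" using cos_gt_zero[of x] that by simp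
      show ?thesis unfolding f'_def
        by (rule DERIV_cong, (rule derivative_intros cos)+) simp
    qed
    show "(?f \<longlongrightarrow> 0) (at_right 0)" by real_asymp
  qed (use f'_pos assms in auto)
  then show ?thesis by simp
qed

text \<open>Wilker's inequality at the half angle, multiplied by 4 cos^2 u and rewritten by the
  double-angle formulas, is this claim times \<open>t\<^sup>2\<close>.\<close>

lemma sinc_plus_sinc_sq_gt:
  fixes t :: real
  assumes "0 < t" "t < pi"
  shows "1 + cos t < sin t / t + (sin t / t)\<^sup>2"
proof -
  define u where "u = t / 2"
  have u: "0 < u" "u < pi / 2" and t: "t = 2 * u" using assms by (auto simp: u_def)
  have c: "0 < cos u" using u by (intro cos_gt_zero) auto
  have "(2 * u\<^sup>2) * (cos u)\<^sup>2 < (u * tan u + (sin u)\<^sup>2) * (cos u)\<^sup>2"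
    using Wilker[OF u] c by (intro mult_strict_right_mono) auto
  moreover have "u * tan u * (cos u)\<^sup>2 = u * sin u * cos u"
    using c by (simp add: tan_def power2_eq_square)
  ultimately have "4 * (2 * u\<^sup>2 * (cos u)\<^sup>2) < 4 * (u * sin u * cos u + (sin u)\<^sup>2 * (cos u)\<^sup>2)"
    by (simp add: distrib_right)
  also have "\<dots> = t * sin t + (sin t)\<^sup>2"
    unfolding t sin_double by (simp add: power2_eq_square)
  also have "4 * (2 * u\<^sup>2 * (cos u)\<^sup>2) = t\<^sup>2 * (1 + cos t)"
    unfolding t cos_double_cos by (simp add: power2_eq_square)
  finally have "t\<^sup>2 * (1 + cos t) < t * sin t + (sin t)\<^sup>2" .
  then show ?thesis
    using assms by (simp add: divide_simps power2_eq_square mult.commute)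
qed

section \<open>The three inequalities in the variable \<open>t\<close>\<close>

lemma DERIV_mult_cot:
  fixes x :: real
  assumes "sin x \<noteq> 0"
  shows "((\<lambda>t. t * cos t / sin t) has_real_derivative cos x / sin x - x / (sin x)\<^sup>2) (at x)"
proof (rule DERIV_cong)
  show "((\<lambda>t. t * cos t / sin t) has_real_derivative
      ((1 * cos x + - sin x * 1 * x) * sin x - x * cos x * (cos x * 1)) / (sin x * sin x)) (at x)"
    by (rule derivative_intros assms)+
  have "(cos x - sin x * x) * sin x - x * cos x * cos x = cos x * sin x - x"
    using sin_cos_squared_add[of x] by algebra
  then show "((1 * cos x + - sin x * 1 * x) * sin x - x * cos x * (cos x * 1)) / (sin x * sin x)
      = cos x / sin x - x / (sin x)\<^sup>2"
    using assms by (simp add: diff_divide_distrib power2_eq_square)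
qed

text \<open>This is \<open>X < P\<^sup>2 / A\<close> divided by \<open>A\<close>. The difference of
  logarithms tends to 0 since \<open>t * cos t / sin t\<close> and \<open>sin t / t\<close> both
  tend to 1.\<close>

lemma exp_less_sinc_sq:
  fixes t :: real
  assumes "0 < t" "t < pi / 2"
  shows "exp (t * cos t / sin t - 1) < (sin t / t)\<^sup>2"
proof -
  have sin_pos: "0 < sin x" if "0 < x" "x < pi / 2" for x :: real
    using that by (intro sin_gt_zero) auto
  let ?f = "\<lambda>t::real. 2 * ln (sin t / t) - (t * cos t / sin t - 1)"
  have "0 < ?f t"
  proof (rule pos_if_deriv_pos_tendsto_0[where f = ?f and B = "pi / 2"
      and f' = "\<lambda>t. (t\<^sup>2 + t * sin t * cos t - 2 * (sin t)\<^sup>2) / (t * (sin t)\<^sup>2)"])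
    show "(?f has_real_derivative
        (x\<^sup>2 + x * sin x * cos x - 2 * (sin x)\<^sup>2) / (x * (sin x)\<^sup>2)) (at x)"
      if x: "0 < x" "x < pi / 2" for x
    proof -
      have nz: "x \<noteq> 0" "sin x \<noteq> 0" "0 < sin x / x" using x sin_pos[OF x] by auto
      show ?thesis
        by (rule DERIV_cong, (rule derivative_intros DERIV_mult_cot nz)+)
          (use nz(1,2) in \<open>simp add: field_simps power2_eq_square\<close>)
    qed
    show "(?f \<longlongrightarrow> 0) (at_right 0)"
      by real_asymp
    show "(x\<^sup>2 + x * sin x * cos x - 2 * (sin x)\<^sup>2) / (x * (sin x)\<^sup>2) > 0"
      if "0 < x" "x < pi / 2" for x :: real
      using two_sin_sq_less[OF that] sin_pos[OF that] that by simp
  qed (use assms in auto)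
  then have "exp (t * cos t / sin t - 1) < exp (2 * ln (sin t / t))" by simp
  also have "\<dots> = (sin t / t)\<^sup>2"
    using assms sin_pos[OF assms] by (simp add: exp_double)
  finally show ?thesis .
qed

text \<open>This is \<open>A + G - P < X\<close> divided by \<open>A\<close>. The left side is
  positive on this range, so logarithms may be compared.\<close>

lemma one_plus_cos_minus_sinc_less_exp:
  fixes t :: real
  assumes "0 < t" "t < pi / 2"
  shows "1 + cos t - sin t / t < exp (t * cos t / sin t - 1)"
proof -
  have sin_pos: "0 < sin x" if "0 < x" "x < pi / 2" for x :: real
    using that by (intro sin_gt_zero) auto
  have sinc_less: "sin x / x < 1" if "0 < x" "x < pi / 2" for x :: real
    using that sin_less_self[of x] by simp
  have D_pos: "0 < 1 + cos x - sin x / x" if "0 < x" "x < pi / 2" for x :: real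
    using sinc_less[of x] cos_gt_zero[of x] that by linarith
  let ?f = "\<lambda>t::real. t * cos t / sin t - 1 - ln (1 + cos t - sin t / t)"
  have "0 < ?f t"
  proof (rule pos_if_deriv_pos_tendsto_0[where f = ?f and B = "pi / 2"
      and f' = "\<lambda>t. (1 - sin t / t) * (sin t / t + (sin t / t)\<^sup>2 - (1 + cos t)) * t
        / ((sin t)\<^sup>2 * (1 + cos t - sin t / t))"])
    show "(?f has_real_derivative
        (1 - sin x / x) * (sin x / x + (sin x / x)\<^sup>2 - (1 + cos x)) * x
        / ((sin x)\<^sup>2 * (1 + cos x - sin x / x))) (at x)"
      if x: "0 < x" "x < pi / 2" for x
    proof -
      define s where "s = sin x / x"
      define D where "D = 1 + cos x - s"
      \<comment> \<open>\<open>E\<close> is minus the derivative of \<open>D\<close>, so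
        \<open>- ln D\<close> contributes \<open>E / D\<close>.\<close>
      define E where "E = sin x + (cos x - s) / x"
      have nz: "x \<noteq> 0" "sin x \<noteq> 0" "D > 0" and sin: "sin x = s * x"
        using x sin_pos[OF x] D_pos[OF x] by (auto simp: D_def s_def)
      have "(?f has_real_derivative cos x / sin x - x / (sin x)\<^sup>2 + E / D) (at x)"
        by (rule DERIV_cong, (rule derivative_intros DERIV_mult_cot nz(1,2)
              nz(3)[unfolded D_def s_def])+)
          (use nz in \<open>simp add: D_def E_def s_def diff_divide_distrib add_divide_distrib\<close>)
      also have "cos x / sin x - x / (sin x)\<^sup>2 + E / D
          = ((sin x * cos x - x) * D + (sin x)\<^sup>2 * E) / ((sin x)\<^sup>2 * D)"
        using nz by (simp add: field_simps power2_eq_square)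
      also have "(sin x * cos x - x) * D + (sin x)\<^sup>2 * E
          = x * ((s * cos x - 1) * D + s * (sin x)\<^sup>2 + s\<^sup>2 * (cos x - s))"
        using nz(1) by (simp add: E_def sin field_simps power2_eq_square)
      \<comment> \<open>With c = \<open>cos x\<close> and sin^2 x = 1 - c^2, the factors beside
        \<open>x\<close> on both sides expand to 2 s - 1 - c - s^3 + s c.\<close>
      also have "\<dots> = (1 - s) * (s + s\<^sup>2 - (1 + cos x)) * x"
        unfolding sin_squared_eq D_def by (simp add: algebra_simps power2_eq_square)
      finally show ?thesis
        by (simp add: D_def s_def)
    qed
    show "(?f \<longlongrightarrow> 0) (at_right 0)"
      by real_asymp
    show "(1 - sin x / x) * (sin x / x + (sin x / x)\<^sup>2 - (1 + cos x)) * x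
        / ((sin x)\<^sup>2 * (1 + cos x - sin x / x)) > 0"
      if "0 < x" "x < pi / 2" for x :: real
      using sinc_plus_sinc_sq_gt[of x] sin_pos[OF that] sinc_less[of x] D_pos[OF that] that
      by (intro divide_pos_pos mult_pos_pos) auto
  qed (use assms in auto)
  then have "exp (ln (1 + cos t - sin t / t)) < exp (t * cos t / sin t - 1)" by simp
  then show ?thesis
    using D_pos[OF assms] by simp
qed

text \<open>With u = t/2, sin t / t = (sin u / u) cos u < cos u, and the right side is cos^2
  u.\<close>

lemma sinc_sq_less:
  fixes t :: real
  assumes "0 < t" "t < pi"
  shows "(sin t / t)\<^sup>2 < (1 + cos t) / 2"
proof -
  define u where "u = t / 2"
  have u: "0 < u" "u < pi / 2" and t: "t = 2 * u" using assms by (auto simp: u_def)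
  have c: "0 < cos u" using u by (intro cos_gt_zero) auto
  have "sin t / t < cos u"
    using sin_less_self[of u] u c by (simp add: t sin_double divide_simps)
  moreover have "0 < sin t / t" using assms by (simp add: sin_gt_zero)
  ultimately have "(sin t / t)\<^sup>2 < (cos u)\<^sup>2" by (intro power_strict_mono) auto
  then show ?thesis by (simp add: t cos_double_cos)
qed

section \<open>Expressing the means through \<open>A\<close> and \<open>t\<close>\<close>

theorem theorem2p13:
  fixes a b :: real
  assumes "a > 0" and "b > 0" and "a \<noteq> b"
  shows "arithmetic_mean a b + geometric_mean a b - seiffert_mean a b < X_mean a b
    \<and> X_mean a b < (seiffert_mean a b)\<^sup>2 / arithmetic_mean a b
    \<and> (seiffert_mean a b)\<^sup>2 / arithmetic_mean a b < (arithmetic_mean a b + geometric_mean a b) / 2"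
proof -
  define A where "A = arithmetic_mean a b"
  define r where "r = (a - b) / (a + b)"
  \<comment> \<open>The absolute value covers a < b as well as a > b: \<open>sin t / t\<close>,
    \<open>cos t\<close> and \<open>t * cos t / sin t\<close> are even in \<open>t\<close>.\<close>
  define t where "t = \<bar>arcsin r\<bar>"
  have A: "A > 0" using assms by (simp add: A_def arithmetic_mean_def)
  have r: "-1 < r" "r < 1" "r \<noteq> 0" using assms by (auto simp: r_def divide_simps)
  have t: "0 < t" "t < pi / 2"
    using r arcsin_lt_bounded[of r] arcsin_eq_iff[of r 0] by (auto simp: t_def)
  have sinc: "sin t / t = r / arcsin r"
    using r by (simp add: t_def abs_if)
  have P: "seiffert_mean a b = A * (sin t / t)"
    unfolding sinc using assms
    by (simp add: seiffert_mean_def A_def arithmetic_mean_def r_def)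
  have cos: "cos t = sqrt (1 - r\<^sup>2)"
    using r by (simp add: t_def abs_if cos_arcsin)
  \<comment> \<open>Prepares \<open>G\<close>: the product \<open>a * b\<close> is the squared half
    sum minus the squared half difference, hence A^2 (1 - r^2) = (A cos t)^2.\<close>
  have "A * r = (a - b) / 2"
    using assms by (simp add: A_def arithmetic_mean_def r_def field_simps)
  moreover have "a * b = A\<^sup>2 - ((a - b) / 2)\<^sup>2"
    by (simp add: A_def arithmetic_mean_def field_simps power2_eq_square)
  ultimately have "a * b = A\<^sup>2 * (1 - r\<^sup>2)"
    by (metis mult.right_neutral power_mult_distrib right_diff_distrib)
  then have G: "geometric_mean a b = A * cos t"
    using A by (simp add: geometric_mean_def real_sqrt_mult cos)
  have X: "X_mean a b = A * exp (t * cos t / sin t - 1)"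
    using A by (simp add: X_mean_def P G A_def[symmetric] mult.commute)
  have PP: "(seiffert_mean a b)\<^sup>2 / A = A * (sin t / t)\<^sup>2"
    using A by (simp add: P power2_eq_square)
  have "A + geometric_mean a b - seiffert_mean a b = A * (1 + cos t - sin t / t)"
    "(A + geometric_mean a b) / 2 = A * ((1 + cos t) / 2)"
    by (simp_all add: P G algebra_simps)
  then show ?thesis
    unfolding A_def[symmetric] PP X
    using A t one_plus_cos_minus_sinc_less_exp[of t] exp_less_sinc_sq[of t] sinc_sq_less[of t]
    by (simp only: mult_less_cancel_left_pos)
qed

end
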